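(* Let $\alpha,\beta>-1$ and $M,N>0$. Then $$\lim_{n\to+\infty}\frac{\lVert Q_n^{M,N}\rVert_S}{\lVert\tilde P_n^{(\alpha,\beta)}\rVert_\mu}=1.$$
   Context: Let $d\mu(x)=(1-x)^\alpha(1+x)^\beta\,dx$ on $(-1,1)$, $\lVert p\rVert_\mu^2=\int_{-1}^1p(x)^2\,d\mu(x)$, and let $P_n^{(\alpha,\beta)}$ be the monic Jacobi polynomials, orthogonal with respect to $\mu$. Set $$\tilde P_n^{(\alpha,\beta)}(x)=\frac{(n+\alpha+\beta+1)_n}{2^n(\alpha+1)_n}P_n^{(\alpha,\beta)}(x),$$ where $(y)_n=y(y+1)\cdots(y+n-1)$ is the Pochhammer symbol (equivalently, $\tilde P_n^{(\alpha,\beta)}(1)=1$). The polynomials $Q_n^{M,N}$, $\deg Q_n^{M,N}=n$, are orthogonal with respect to the Sobolev inner product $$\langle p,q\rangle_S=\int_{-1}^1p(x)q(x)\,d\mu(x)+Mp(-1)q(-1)+Np'(-1)q'(-1),$$ normalized so that $Q_n^{M,N}$ has the same leading coefficient as $\tilde P_n^{(\alpha,\beta)}$, and $\lVert p\rVert_S^2=\langle p,p\rangle_S$. *)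

theory Defs
  imports "HOL-Analysis.Analysis" "HOL-Computational_Algebra.Polynomial"
begin

definition jacobi_measure :: "real \<Rightarrow> real \<Rightarrow> real measure" where
  "jacobi_measure \<alpha> \<beta> =
     density lborel (\<lambda>x. ennreal (indicator {-1<..<1} x * ((1 - x) powr \<alpha> * (1 + x) powr \<beta>)))"

definition mu_inner :: "real \<Rightarrow> real \<Rightarrow> real poly \<Rightarrow> real poly \<Rightarrow> real" where
  "mu_inner \<alpha> \<beta> p q = (\<integral>x. poly p x * poly q x \<partial>jacobi_measure \<alpha> \<beta>)"

definition mu_norm :: "real \<Rightarrow> real \<Rightarrow> real poly \<Rightarrow> real" where
  "mu_norm \<alpha> \<beta> p = sqrt (mu_inner \<alpha> \<beta> p p)"

definition sobolev_inner ::
    "real \<Rightarrow> real \<Rightarrow> real \<Rightarrow> real \<Rightarrow> real poly \<Rightarrow> real poly \<Rightarrow> real" where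
  "sobolev_inner \<alpha> \<beta> M N p q =
     mu_inner \<alpha> \<beta> p q + M * poly p (-1) * poly q (-1)
       + N * poly (pderiv p) (-1) * poly (pderiv q) (-1)"

definition sobolev_norm :: "real \<Rightarrow> real \<Rightarrow> real \<Rightarrow> real \<Rightarrow> real poly \<Rightarrow> real" where
  "sobolev_norm \<alpha> \<beta> M N p = sqrt (sobolev_inner \<alpha> \<beta> M N p p)"

text \<open>
  The sequence of polynomials of degree \<open>n\<close> with leading coefficient \<open>c n\<close> that are pairwise
  orthogonal for the form \<open>ip\<close>. It exists and is unique (Gram--Schmidt) whenever \<open>ip\<close> is an
  inner product on the real polynomials and no \<open>c n\<close> vanishes.
\<close>

definition orthogonal_polys ::
    "(real poly \<Rightarrow> real poly \<Rightarrow> real) \<Rightarrow> (nat \<Rightarrow> real) \<Rightarrow> nat \<Rightarrow> real poly" where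
  "orthogonal_polys ip c =
     (THE P. (\<forall>n. degree (P n) = n \<and> lead_coeff (P n) = c n) \<and>
             (\<forall>m n. m \<noteq> n \<longrightarrow> ip (P m) (P n) = 0))"

definition jacobi_monic :: "real \<Rightarrow> real \<Rightarrow> nat \<Rightarrow> real poly" where
  "jacobi_monic \<alpha> \<beta> = orthogonal_polys (mu_inner \<alpha> \<beta>) (\<lambda>n. 1)"

definition jacobi_tilde :: "real \<Rightarrow> real \<Rightarrow> nat \<Rightarrow> real poly" where
  "jacobi_tilde \<alpha> \<beta> n =
     smult (pochhammer (real n + \<alpha> + \<beta> + 1) n / (2 ^ n * pochhammer (\<alpha> + 1) n))
       (jacobi_monic \<alpha> \<beta> n)"

definition jacobi_sobolev :: "real \<Rightarrow> real \<Rightarrow> real \<Rightarrow> real \<Rightarrow> nat \<Rightarrow> real poly" where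
  "jacobi_sobolev \<alpha> \<beta> M N =
     orthogonal_polys (sobolev_inner \<alpha> \<beta> M N) (\<lambda>n. lead_coeff (jacobi_tilde \<alpha> \<beta> n))"

end

theory Submission
  imports Defs "HOL-Real_Asymp.Real_Asymp"
begin

text \<open>
  After division by the common leading coefficient, the squared Sobolev norm of \<open>Q\<^sub>n\<close> is the
  minimum of \<open>\<langle>p, p\<rangle>\<^sub>S\<close> over the monic \<open>p\<close> of degree \<open>n\<close>, and the squared \<open>\<mu>\<close>-norm of
  \<open>P\<^sub>n\<close> is the minimum of \<open>\<parallel>p\<parallel>\<^sub>\<mu>\<^sup>2\<close> over the same set. Write \<open>h\<^sub>n(\<alpha>, \<beta>)\<close> for the latter
  minimum. Since the mass terms are nonnegative, the Sobolev minimum is at least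
  \<open>h\<^sub>n(\<alpha>, \<beta>)\<close>, so the ratio of the norms is at least 1. Conversely, the mass terms vanish on
  the polynomials \<open>(1 + x)\<^sup>2 q(x)\<close>, and on these the Sobolev norm is the norm of \<open>q\<close> for the
  parameters \<open>\<alpha>\<close> and \<open>\<beta> + 4\<close>. Choosing \<open>q\<close> optimally bounds the Sobolev minimum by
  \<open>h\<close> at index \<open>n - 2\<close> and parameters \<open>(\<alpha>, \<beta> + 4)\<close>.

  It remains to see that the two bounds are asymptotically equal. Each raising of \<open>\<beta>\<close> by 2 with a
  lowering of the degree by 1 multiplies \<open>h\<close> by an explicit rational function of \<open>n\<close> that tends
  to 1 (\<open>jacobi_monic_norm2_shift\<close>). One
  integration by parts, \<open>jacobi_integral_by_parts\<close>, shows that differentiation maps the orthogonal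
  polynomials for \<open>(\<alpha>, \<beta>)\<close> to those for \<open>(\<alpha> + 1, \<beta> + 1)\<close> up to a factor, which relates the
  two norms (\<open>jacobi_monic_norm2_Suc\<close>). By induction on the degree, the same relation reduces the
  comparison of \<open>(\<alpha>, \<beta> + 1)\<close> with \<open>(\<alpha> + 1, \<beta>)\<close> to degree 0
  (\<open>jacobi_monic_norm2_swap\<close>), and the two relations together give the factor.
\<close>

section \<open>Orthogonal polynomials of a positive definite form\<close>

text \<open>
  Unlike the condition \<open>degree p < n\<close>, this one holds for the zero polynomial also when \<open>n = 0\<close>,
  so that \<open>polys_below n\<close> is a vector space of dimension \<open>n\<close> for every \<open>n\<close>.
\<close>

definition polys_below :: "nat \<Rightarrow> 'a::zero poly set" where
  "polys_below n = {p. \<forall>i\<ge>n. coeff p i = 0}"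

lemma polys_below_Suc_iff_degree: "p \<in> polys_below (Suc n) \<longleftrightarrow> degree p \<le> n"
  by (auto simp: polys_below_def coeff_eq_0 Suc_le_eq intro: degree_le)

lemma polys_below_0_iff: "p \<in> polys_below 0 \<longleftrightarrow> p = 0"
  by (auto simp: polys_below_def poly_eq_iff)

lemma degree_less_imp_polys_below: "degree p < n \<Longrightarrow> p \<in> polys_below n"
  by (auto simp: polys_below_def coeff_eq_0)

lemma degree_le_imp_polys_below:
  assumes "degree p \<le> n" "coeff p n = 0"
  shows "p \<in> polys_below n"
  unfolding polys_below_def
proof safe
  fix i assume "n \<le> i"
  then show "coeff p i = 0" using assms by (cases "i = n") (auto intro: coeff_eq_0)
qed

lemma polys_below_reduce:
  fixes p s :: "'a::field poly"
  assumes "s \<in> polys_below (Suc n)" "p \<in> polys_below (Suc n)" "coeff p n \<noteq> 0"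
  shows "s - smult (coeff s n / coeff p n) p \<in> polys_below n"
  unfolding polys_below_def
proof safe
  fix i assume "n \<le> i"
  then show "coeff (s - smult (coeff s n / coeff p n) p) i = 0"
    using assms by (cases "i = n") (auto simp: polys_below_def)
qed

locale poly_inner_product =
  fixes ip :: "real poly \<Rightarrow> real poly \<Rightarrow> real"
  assumes add_left: "ip (p + q) r = ip p r + ip q r"
    and smult_left: "ip (smult k p) r = k * ip p r"
    and sym: "ip p q = ip q p"
    and pos: "p \<noteq> 0 \<Longrightarrow> ip p p > 0"
begin

lemma add_right: "ip r (p + q) = ip r p + ip r q"
  using add_left[of p q r] by (simp add: sym)

lemma smult_right: "ip r (smult k p) = k * ip r p"
  using smult_left[of k p r] by (simp add: sym)

lemma zero_left [simp]: "ip 0 r = 0"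
  using smult_left[of 0 0 r] by simp

lemma zero_right [simp]: "ip r 0 = 0"
  using zero_left by (simp add: sym)

lemma diff_left: "ip (p - q) r = ip p r - ip q r"
  using add_left[of "p - q" q r] by simp

lemma diff_right: "ip r (p - q) = ip r p - ip r q"
  using diff_left[of p q r] by (simp add: sym)

lemma nonneg: "ip p p \<ge> 0"
  using pos[of p] by (cases "p = 0") auto

text \<open>
  The inductive step of Gram--Schmidt: the residue \<open>u\<close> of the monomial of degree \<open>n\<close> spans the
  orthogonal complement of \<open>polys_below n\<close> in \<open>polys_below (Suc n)\<close>, so the projection to
  the larger space arises from the smaller one by adding the component along \<open>u\<close>.
\<close>

lemma projection_exists:
  "\<exists>r\<in>polys_below n. \<forall>s\<in>polys_below n. ip (q - r) s = 0"
proof (induction n arbitrary: q)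
  case 0
  have "(0 :: real poly) \<in> polys_below 0" by (simp add: polys_below_def)
  then show ?case by (auto simp: polys_below_0_iff)
next
  case (Suc n)
  obtain v where v: "v \<in> polys_below n" "\<And>s. s \<in> polys_below n \<Longrightarrow> ip (monom 1 n - v) s = 0"
    using Suc.IH[of "monom 1 n"] by blast
  obtain r where r: "r \<in> polys_below n" "\<And>s. s \<in> polys_below n \<Longrightarrow> ip (q - r) s = 0"
    using Suc.IH[of q] by blast
  define u where "u = monom 1 n - v"
  have u: "u \<in> polys_below (Suc n)" "coeff u n = 1"
    using v(1) by (auto simp: u_def polys_below_def)
  then have "ip u u > 0" by (intro pos) auto
  define k where "k = ip (q - r) u / ip u u"
  define r' where "r' = r + smult k u"
  have "r' \<in> polys_below (Suc n)"
    using r(1) u(1) by (auto simp: r'_def polys_below_def)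
  moreover have "ip (q - r') s = 0" if s: "s \<in> polys_below (Suc n)" for s
  proof -
    define t where "t = s - smult (coeff s n) u"
    have t: "t \<in> polys_below n"
      using polys_below_reduce[OF s u(1)] u(2) by (simp add: t_def)
    have split: "ip (q - r') w = ip (q - r) w - k * ip u w" for w
      by (simp add: r'_def diff_left add_left smult_left)
    have "ip (q - r') t = 0" unfolding split using r(2)[OF t] v(2)[OF t] by (simp add: u_def)
    moreover have "ip (q - r') u = 0"
      unfolding split using \<open>ip u u > 0\<close> by (simp add: k_def)
    moreover have "s = t + smult (coeff s n) u" by (simp add: t_def)
    ultimately show ?thesis
      by (metis add_right smult_right mult_zero_right add_0)
  qed
  ultimately show ?case by blast
qed

lemma orthogonal_poly_exists:
  assumes "c \<noteq> 0"
  shows "\<exists>p. degree p = n \<and> lead_coeff p = c \<and> (\<forall>s\<in>polys_below n. ip p s = 0)"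
proof -
  obtain r where r: "r \<in> polys_below n" "\<And>s. s \<in> polys_below n \<Longrightarrow> ip (monom c n - r) s = 0"
    using projection_exists[of n "monom c n"] by blast
  let ?p = "monom c n - r"
  have "coeff ?p n = c" "?p \<in> polys_below (Suc n)"
    using r(1) by (auto simp: polys_below_def)
  then have "degree ?p = n"
    using assms by (intro antisym le_degree) (auto simp: polys_below_Suc_iff_degree)
  then show ?thesis using \<open>coeff ?p n = c\<close> r(2) by (intro exI[of _ ?p]) auto
qed

text \<open>
  One polynomial of each degree below \<open>m\<close> forms a basis of \<open>polys_below m\<close>; the induction removes
  the leading terms of \<open>s\<close> one at a time.
\<close>

lemma pairwise_orthogonal_imp_orthogonal_below:
  assumes deg: "\<And>k. degree (P k) = k" and lc: "\<And>k. lead_coeff (P k) \<noteq> 0"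
    and orth: "\<And>k l. k \<noteq> l \<Longrightarrow> ip (P k) (P l) = 0"
  shows "m \<le> n \<Longrightarrow> s \<in> polys_below m \<Longrightarrow> ip (P n) s = 0"
proof (induction m arbitrary: s)
  case 0
  then show ?case by (simp add: polys_below_0_iff)
next
  case (Suc m)
  let ?k = "coeff s m / coeff (P m) m"
  have "s - smult ?k (P m) \<in> polys_below m"
    using Suc.prems(2) deg[of m] lc[of m]
    by (intro polys_below_reduce) (auto simp: polys_below_Suc_iff_degree)
  then have "ip (P n) (s - smult ?k (P m)) = 0" using Suc by auto
  then show ?case using orth[of n m] Suc.prems(1) by (simp add: diff_right smult_right)
qed

text \<open>
  Orthogonality to all polynomials of lower degree is equivalent to pairwise orthogonality and,
  with the leading coefficient, determines each polynomial separately: the difference of two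
  candidates has lower degree and is orthogonal to itself. This justifies the definite description in the definition.
\<close>

lemma orthogonal_polys_spec:
  assumes c: "\<And>n. c n \<noteq> 0"
  shows degree_orthogonal_polys: "degree (orthogonal_polys ip c n) = n"
    and orthogonal_polys_below: "s \<in> polys_below n \<Longrightarrow> ip (orthogonal_polys ip c n) s = 0"
    and coeff_orthogonal_polys: "coeff (orthogonal_polys ip c n) n = c n"
proof -
  let ?S = "\<lambda>P. (\<forall>n. degree (P n) = n \<and> lead_coeff (P n) = c n) \<and>
             (\<forall>m n. m \<noteq> n \<longrightarrow> ip (P m) (P n) = 0)"
  have below: "ip (P n) s = 0" if "?S P" "s \<in> polys_below n" for P n s
    using that c by (intro pairwise_orthogonal_imp_orthogonal_below[of P n n s]) (metis order.refl)+
  obtain P where P: "\<And>n. degree (P n) = n" "\<And>n. lead_coeff (P n) = c n"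
      "\<And>n s. s \<in> polys_below n \<Longrightarrow> ip (P n) s = 0"
  proof -
    have "\<forall>n. \<exists>p. degree p = n \<and> lead_coeff p = c n \<and> (\<forall>s\<in>polys_below n. ip p s = 0)"
      using orthogonal_poly_exists c by blast
    then show ?thesis using that by metis
  qed
  have "ip (P m) (P n) = 0" if "m \<noteq> n" for m n
    using that P(3)[OF degree_less_imp_polys_below, of "P n" m]
      P(3)[OF degree_less_imp_polys_below, of "P m" n] P(1) sym
    by (metis linorder_neqE_nat)
  then have ex: "?S P" using P by blast
  have "Q = P" if Q: "?S Q" for Q
  proof
    fix n
    let ?d = "Q n - P n"
    have "degree ?d \<le> n" using Q P(1) by (intro degree_diff_le) auto
    moreover have "coeff ?d n = 0" using Q P(1,2) by (metis coeff_diff diff_self)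
    ultimately have "?d \<in> polys_below n"
      by (rule degree_le_imp_polys_below)
    then have "ip ?d ?d = 0" using below[OF Q] below[OF ex] by (simp add: diff_left)
    then show "Q n = P n" using pos[of ?d] by auto
  qed
  then have "?S (orthogonal_polys ip c)"
    unfolding orthogonal_polys_def by (rule theI[where P = ?S, OF ex])
  then show deg: "degree (orthogonal_polys ip c n) = n"
    and "s \<in> polys_below n \<Longrightarrow> ip (orthogonal_polys ip c n) s = 0"
    and "coeff (orthogonal_polys ip c n) n = c n"
    using below[of "orthogonal_polys ip c" s n] by (blast, blast, metis)
qed

lemma orthogonal_polys_inner:
  assumes c: "\<And>n. c n \<noteq> 0" and s: "degree s \<le> n"
  defines "P \<equiv> orthogonal_polys ip c"
  shows "ip (P n) s = coeff s n / c n * ip (P n) (P n)"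
proof -
  have "s - smult (coeff s n / c n) (P n) \<in> polys_below n"
    using polys_below_reduce[of s n "P n"] s c[of n]
    by (simp add: polys_below_Suc_iff_degree degree_orthogonal_polys[OF c]
        coeff_orthogonal_polys[OF c] P_def)
  then have "ip (P n) (s - smult (coeff s n / c n) (P n)) = 0"
    unfolding P_def by (rule orthogonal_polys_below[OF c])
  then show ?thesis by (simp add: diff_right smult_right)
qed

text \<open>
  The extremal property, by Pythagoras: \<open>s\<close> splits into a multiple of \<open>P n\<close> and a
  component orthogonal to it.
\<close>

lemma orthogonal_polys_minimal:
  assumes c: "\<And>n. c n \<noteq> 0" and s: "degree s \<le> n"
  defines "P \<equiv> orthogonal_polys ip c"
  shows "(coeff s n / c n)\<^sup>2 * ip (P n) (P n) \<le> ip s s"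
proof -
  let ?k = "coeff s n / c n"
  have "0 \<le> ip (s - smult ?k (P n)) (s - smult ?k (P n))" by (rule nonneg)
  also have "\<dots> = ip s s - 2 * ?k * ip (P n) s + ?k\<^sup>2 * ip (P n) (P n)"
    by (simp add: diff_left diff_right smult_left smult_right sym[of s "P n"] power2_eq_square
        algebra_simps)
  also have "\<dots> = ip s s - ?k\<^sup>2 * ip (P n) (P n)"
    unfolding P_def orthogonal_polys_inner[OF c s] by (simp add: power2_eq_square)
  finally show ?thesis by simp
qed

end

section \<open>The Jacobi inner product\<close>

definition jacobi_weight :: "real \<Rightarrow> real \<Rightarrow> real \<Rightarrow> real" where
  "jacobi_weight a b x = indicator {-1<..<1} x * ((1 - x) powr a * (1 + x) powr b)"

lemma jacobi_weight_nonneg: "jacobi_weight a b x \<ge> 0"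
  by (auto simp: jacobi_weight_def)

lemma jacobi_weight_measurable [measurable]: "jacobi_weight a b \<in> borel_measurable borel"
  unfolding jacobi_weight_def by measurable

lemma jacobi_weight_add_nat:
  "jacobi_weight (a + real i) (b + real j) x = (1 - x) ^ i * (1 + x) ^ j * jacobi_weight a b x"
  by (auto simp: jacobi_weight_def powr_add powr_realpow indicator_def)

lemma poly_measurable [measurable]: "poly (p :: real poly) \<in> borel_measurable borel"
  by (intro borel_measurable_continuous_onI continuous_intros)

text \<open>The substitution \<open>t = (1 + x) / 2\<close> turns the Beta integrand into the weight.\<close>

lemma integrable_jacobi_weight:
  assumes "a > -1" "b > -1"
  shows "integrable lborel (jacobi_weight a b)"
proof -
  have "integrable lborel (\<lambda>t. indicator {0..1} t * (t powr b * (1 - t) powr a))"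
    using integrable_Beta[of "b + 1" "a + 1"] assms by (simp add: set_integrable_def)
  then have "integrable lborel (\<lambda>x. indicator {0..1} (1/2 + 1/2 * x) *
      ((1/2 + 1/2 * x) powr b * (1 - (1/2 + 1/2 * x)) powr a))"
    by (rule lborel_integrable_real_affine) auto
  then have "integrable lborel (\<lambda>x. 2 powr (a + b) * (indicator {0..1} (1/2 + 1/2 * x) *
      ((1/2 + 1/2 * x) powr b * (1 - (1/2 + 1/2 * x)) powr a)))"
    by (rule integrable_mult_right)
  moreover have "2 powr (a + b) * (indicator {0..1} (1/2 + 1/2 * x) *
      ((1/2 + 1/2 * x) powr b * (1 - (1/2 + 1/2 * x)) powr a)) = jacobi_weight a b x" for x :: real
  proof (cases "x \<in> {-1<..<1}")
    case True
    have "1/2 + 1/2 * x = (1 + x) / 2" "1 - (1/2 + 1/2 * x) = (1 - x) / 2"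
      by (simp_all add: field_simps)
    moreover have "(1 + x) / 2 \<in> {0..1}" using True by auto
    ultimately show ?thesis
      using True by (simp only:) (simp add: jacobi_weight_def powr_divide powr_add)
  next
    case False
    then consider "x = 1" | "x = -1" | "x < -1" | "x > 1" by force
    then show ?thesis by cases (auto simp: jacobi_weight_def)
  qed
  ultimately show ?thesis by (simp only:)
qed

lemma integrable_poly_jacobi_weight:
  assumes "a > -1" "b > -1"
  shows "integrable lborel (\<lambda>x. poly p x * jacobi_weight a b x)"
proof -
  have "compact (poly p ` {-1..1})"
    by (intro compact_continuous_image continuous_intros) auto
  then obtain B where B: "\<And>x. x \<in> {-1..1} \<Longrightarrow> \<bar>poly p x\<bar> \<le> B"
    using compact_imp_bounded[of "poly p ` {-1..1}"] unfolding bounded_iff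
    by (metis imageI real_norm_def)
  show ?thesis
  proof (rule Bochner_Integration.integrable_bound)
    show "integrable lborel (\<lambda>x. B * jacobi_weight a b x)"
      by (intro integrable_mult_right integrable_jacobi_weight assms)
    show "AE x in lborel. norm (poly p x * jacobi_weight a b x) \<le> norm (B * jacobi_weight a b x)"
    proof (intro AE_I2)
      fix x :: real
      show "norm (poly p x * jacobi_weight a b x) \<le> norm (B * jacobi_weight a b x)"
      proof (cases "x \<in> {-1<..<1}")
        case True
        then have "\<bar>poly p x\<bar> \<le> \<bar>B\<bar>" using B[of x] by auto
        then show ?thesis by (simp add: abs_mult mult_right_mono)
      qed (simp add: jacobi_weight_def)
    qed
  qed simp
qed

text \<open>
  The form \<open>mu_inner\<close> depends on the product of its arguments only. A functional of that
  product makes changes of the parameters and integration by parts plain polynomial algebra.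
\<close>

definition jacobi_integral :: "real \<Rightarrow> real \<Rightarrow> real poly \<Rightarrow> real" where
  "jacobi_integral a b p = (\<integral>x. poly p x * jacobi_weight a b x \<partial>lborel)"

lemma mu_inner_eq: "mu_inner a b p q = jacobi_integral a b (p * q)"
proof -
  have "mu_inner a b p q =
      (\<integral>x. poly p x * poly q x \<partial>density lborel (\<lambda>x. ennreal (jacobi_weight a b x)))"
    by (simp add: mu_inner_def jacobi_measure_def jacobi_weight_def)
  also have "\<dots> = (\<integral>x. jacobi_weight a b x * (poly p x * poly q x) \<partial>lborel)"
    by (subst integral_real_density) (auto simp: jacobi_weight_nonneg)
  finally show ?thesis by (simp add: jacobi_integral_def mult_ac)
qed

lemma jacobi_integral_add:
  assumes "a > -1" "b > -1"
  shows "jacobi_integral a b (p + q) = jacobi_integral a b p + jacobi_integral a b q"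
  using integrable_poly_jacobi_weight[OF assms]
  by (simp add: jacobi_integral_def distrib_right)

lemma jacobi_integral_smult: "jacobi_integral a b (smult k p) = k * jacobi_integral a b p"
  by (simp add: jacobi_integral_def mult.assoc)

lemma jacobi_integral_shift:
  "jacobi_integral (a + real i) (b + real j) p
     = jacobi_integral a b ([:1, -1:] ^ i * [:1, 1:] ^ j * p)"
  by (simp add: jacobi_integral_def jacobi_weight_add_nat mult_ac)

lemma mu_inner_pos:
  assumes "a > -1" "b > -1" "p \<noteq> 0"
  shows "mu_inner a b p p > 0"
proof -
  let ?f = "\<lambda>x. poly (p * p) x * jacobi_weight a b x"
  have int: "integrable lborel ?f" by (intro integrable_poly_jacobi_weight assms)
  have nonneg: "?f x \<ge> 0" for x by (simp add: jacobi_weight_nonneg)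
  have "integral\<^sup>L lborel ?f \<noteq> 0"
  proof
    assume "integral\<^sup>L lborel ?f = 0"
    then have "AE x in lborel. ?f x = 0"
      using integral_nonneg_eq_0_iff_AE[OF int] nonneg by auto
    moreover have "AE x in lborel. x \<notin> {x. poly p x = 0}"
      by (intro AE_not_in finite_imp_null_set_lborel poly_roots_finite assms)
    ultimately have "AE x in lborel. x \<notin> {-1<..<1::real}"
    proof eventually_elim
      case (elim x)
      then show ?case by (auto simp: jacobi_weight_def)
    qed
    then have "emeasure lborel {-1<..<1::real} = 0"
      by (subst (asm) AE_iff_measurable[of "{-1<..<1}"]) auto
    then show False by simp
  qed
  moreover have "integral\<^sup>L lborel ?f \<ge> 0" using nonneg by (intro integral_nonneg_AE) auto
  ultimately show ?thesis by (simp add: mu_inner_eq jacobi_integral_def)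
qed

lemma poly_inner_product_mu:
  assumes "a > -1" "b > -1"
  shows "poly_inner_product (mu_inner a b)"
  using mu_inner_pos[OF assms]
  by unfold_locales (simp_all add: mu_inner_eq distrib_right jacobi_integral_add[OF assms]
      jacobi_integral_smult, simp add: mult.commute)

lemma poly_inner_product_sobolev:
  assumes "a > -1" "b > -1" "M \<ge> 0" "N \<ge> 0"
  shows "poly_inner_product (sobolev_inner a b M N)"
proof -
  interpret mu: poly_inner_product "mu_inner a b" by (rule poly_inner_product_mu[OF assms(1,2)])
  show ?thesis
  proof
    show "sobolev_inner a b M N p p > 0" if "p \<noteq> 0" for p
    proof -
      have "M * poly p (-1) * poly p (-1) \<ge> 0"
        "N * poly (pderiv p) (-1) * poly (pderiv p) (-1) \<ge> 0"
        using assms by (simp_all add: mult.assoc)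
      then show ?thesis using mu.pos[OF that] by (simp add: sobolev_inner_def)
    qed
    show "sobolev_inner a b M N p q = sobolev_inner a b M N q p" for p q
      using mu.sym[of p q] by (simp add: sobolev_inner_def)
  qed (simp_all add: sobolev_inner_def mu.add_left mu.smult_left pderiv_add pderiv_smult
      algebra_simps)
qed

section \<open>Recurrences for the norms of the monic Jacobi polynomials\<close>

text \<open>
  The integrand is the derivative of \<open>(1 - x) powr (a + 1) * (1 + x) powr (b + 1) * poly r x\<close>,
  whose boundary values are 0 because both exponents are positive.
\<close>

lemma jacobi_integral_by_parts:
  assumes a: "a > -1" and b: "b > -1"
  shows "jacobi_integral a b ([:1, 0, -1:] * pderiv r + [:b - a, - (a + b + 2):] * r) = 0"
proof -
  let ?q = "[:1, 0, -1:] * pderiv r + [:b - a, - (a + b + 2):] * r"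
  let ?F = "\<lambda>x. (1 - x) powr (a + 1) * (1 + x) powr (b + 1) * poly r x"
  let ?f = "\<lambda>x. poly ?q x * jacobi_weight a b x"
  have "(?f has_integral (?F 1 - ?F (-1))) {-1..1}"
  proof (rule fundamental_theorem_of_calculus_interior)
    show "continuous_on {-1..1} ?F"
      using a b by (intro continuous_intros continuous_on_powr') auto
    show "(?F has_vector_derivative ?f x) (at x)" if "x \<in> {-1<..<1}" for x
    proof -
      have x: "1 - x > 0" "1 + x > 0" using that by auto
      have p: "(1 - x) powr (a + 1) = (1 - x) powr a * (1 - x)"
        "(1 + x) powr (b + 1) = (1 + x) powr b * (1 + x)"
        using x by (simp_all add: powr_add)
      have "(?F has_real_derivative ?f x) (at x)"
        using x that
        by (auto intro!: derivative_eq_intros simp: jacobi_weight_def p)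
           (simp add: algebra_simps)
      then show ?thesis by (simp add: has_real_derivative_iff_has_vector_derivative)
    qed
  qed auto
  then have "(?f has_integral 0) {-1..1}" using a b by simp
  then have "(?f has_integral 0) UNIV"
    by (rule has_integral_on_superset) (auto simp: jacobi_weight_def)
  moreover have "(?f has_integral jacobi_integral a b ?q) UNIV"
    unfolding jacobi_integral_def
    by (intro has_integral_integral_lborel integrable_poly_jacobi_weight a b)
  ultimately show ?thesis by (rule has_integral_unique[symmetric])
qed

definition jacobi_monic_norm2 :: "real \<Rightarrow> real \<Rightarrow> nat \<Rightarrow> real" where
  "jacobi_monic_norm2 a b n = mu_inner a b (jacobi_monic a b n) (jacobi_monic a b n)"

text \<open>The general theory, specialised to leading coefficient 1.\<close>

context
  fixes a b :: real
  assumes ab: "a > -1" "b > -1"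
begin

interpretation mu: poly_inner_product "mu_inner a b"
  by (rule poly_inner_product_mu[OF ab])

lemma degree_jacobi_monic: "degree (jacobi_monic a b n) = n"
  unfolding jacobi_monic_def by (rule mu.degree_orthogonal_polys) simp

lemma coeff_jacobi_monic: "coeff (jacobi_monic a b n) n = 1"
  unfolding jacobi_monic_def using mu.coeff_orthogonal_polys[of "\<lambda>_. 1"] by simp

lemma jacobi_monic_0: "jacobi_monic a b 0 = 1"
  using degree_jacobi_monic[of 0] coeff_jacobi_monic[of 0]
  by (metis degree_eq_zeroE coeff_pCons_0 one_pCons)

lemma jacobi_monic_norm2_pos: "jacobi_monic_norm2 a b n > 0"
  unfolding jacobi_monic_norm2_def
  using coeff_jacobi_monic[of n] by (intro mu.pos) auto

lemma mu_inner_jacobi_monic: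
  "degree s \<le> n \<Longrightarrow> mu_inner a b (jacobi_monic a b n) s = coeff s n * jacobi_monic_norm2 a b n"
  using mu.orthogonal_polys_inner[of "\<lambda>_. 1" s n]
  by (simp add: jacobi_monic_def jacobi_monic_norm2_def)

lemma jacobi_monic_minimal:
  "degree s \<le> n \<Longrightarrow> (coeff s n)\<^sup>2 * jacobi_monic_norm2 a b n \<le> mu_inner a b s s"
  using mu.orthogonal_polys_minimal[of "\<lambda>_. 1" s n]
  by (simp add: jacobi_monic_def jacobi_monic_norm2_def)

end

text \<open>
  The adjoint of differentiation, taken from the form with parameters \<open>(a, b)\<close> to the form with
  parameters \<open>(a + 1, b + 1)\<close>. It raises the degree by 1, as differentiation lowers it.
\<close>

lemma mu_inner_pderiv:
  assumes ab: "a > -1" "b > -1"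
  shows "mu_inner (a + 1) (b + 1) (pderiv p) r =
     mu_inner a b p ([:a - b, a + b + 2:] * r - [:1, 0, -1:] * pderiv r)"
proof -
  have "mu_inner (a + 1) (b + 1) (pderiv p) r = jacobi_integral a b ([:1, 0, -1:] * (pderiv p * r))"
  proof -
    have "[:1, -1:] * [:1, 1:] = [:1, 0, -1 :: real:]" by simp
    then show ?thesis
      using jacobi_integral_shift[of a 1 b 1 "pderiv p * r"] by (simp only: mu_inner_eq) simp
  qed
  moreover have "[:1, 0, -1:] * (pderiv p * r) =
      ([:1, 0, -1:] * pderiv (p * r) + [:b - a, - (a + b + 2):] * (p * r))
      + p * ([:a - b, a + b + 2:] * r - [:1, 0, -1:] * pderiv r)" (is "_ = ?t + _")
  proof -
    have expand: "A * (p' * r) = (A * (p * r' + r * p') + (- B) * (p * r)) + p * (B * r - A * r')"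
      for A B p' r' :: "real poly"
      by (simp add: algebra_simps)
    have "[:b - a, - (a + b + 2):] = - [:a - b, a + b + 2:]" by simp
    then show ?thesis by (simp only: pderiv_mult expand)
  qed
  moreover have "jacobi_integral a b ?t = 0" by (rule jacobi_integral_by_parts[OF ab])
  ultimately show ?thesis
    by (simp only: jacobi_integral_add[OF ab] mu_inner_eq add_0)
qed

text \<open>
  Both sides are the inner product, for \<open>(a + 1, b + 1)\<close>, of the monic polynomial of degree \<open>n\<close>
  with the derivative of the monic polynomial of degree \<open>n + 1\<close> for \<open>(a, b)\<close>. It can be evaluated
  directly, by comparing leading coefficients, or after moving the derivative to the other side.
\<close>

lemma jacobi_monic_norm2_Suc:
  assumes ab: "a > -1" "b > -1"
  shows "(real n + 1) * jacobi_monic_norm2 (a + 1) (b + 1) n =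
     (real n + a + b + 2) * jacobi_monic_norm2 a b (Suc n)"
proof -
  have ab1: "a + 1 > -1" "b + 1 > -1" using ab by auto
  let ?p = "jacobi_monic a b (Suc n)" and ?r = "jacobi_monic (a + 1) (b + 1) n"
  let ?q = "[:a - b, a + b + 2:] * ?r - [:1, 0, -1:] * pderiv ?r"
  have r: "degree ?r = n" "coeff ?r n = 1"
    by (rule degree_jacobi_monic[OF ab1] coeff_jacobi_monic[OF ab1])+
  have "degree (pderiv ?p) = n"
    by (simp add: degree_pderiv degree_jacobi_monic[OF ab])
  moreover have "coeff (pderiv ?p) n = real n + 1"
    by (simp add: coeff_pderiv coeff_jacobi_monic[OF ab])
  ultimately have "(real n + 1) * jacobi_monic_norm2 (a + 1) (b + 1) n =
      mu_inner (a + 1) (b + 1) ?r (pderiv ?p)"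
    using mu_inner_jacobi_monic[OF ab1, of "pderiv ?p" n] by simp
  also have "\<dots> = mu_inner a b ?p ?q"
    by (rule trans[OF poly_inner_product.sym[OF poly_inner_product_mu[OF ab1]]
          mu_inner_pderiv[OF ab]])
  also have "\<dots> = coeff ?q (Suc n) * jacobi_monic_norm2 a b (Suc n)"
  proof (rule mu_inner_jacobi_monic[OF ab], rule degree_le, intro allI impI)
    fix i assume "Suc n < i"
    then obtain j where "i = Suc (Suc j)" "n \<le> j"
      by (intro that[of "i - 2"]) auto
    then show "coeff ?q i = 0"
      using r by (simp add: coeff_pderiv coeff_eq_0)
  qed
  also have "coeff ?q (Suc n) = real n + a + b + 2"
  proof (cases n)
    case 0
    then show ?thesis using r by (simp add: coeff_pderiv coeff_eq_0)
  next
    case (Suc m)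
    then show ?thesis using r by (simp add: coeff_pderiv coeff_eq_0)
  qed
  finally show ?thesis .
qed

text \<open>
  The factors in \<open>jacobi_monic_norm2_Suc\<close> depend on \<open>a + b\<close> only, hence they agree for
  \<open>(a, b + 1)\<close> and \<open>(a + 1, b)\<close>. The induction therefore reduces the claim to degree 0 with
  both parameters raised by \<open>n\<close>, where it is integration by parts of a constant.
\<close>

lemma jacobi_monic_norm2_swap:
  assumes ab: "a > -1" "b > -1"
  shows "(real n + a + 1) * jacobi_monic_norm2 a (b + 1) n =
     (real n + b + 1) * jacobi_monic_norm2 (a + 1) b n"
  using ab
proof (induction n arbitrary: a b)
  case 0
  have s: "jacobi_integral a b ([:a + 1:] * [:1, 1:]) = jacobi_integral a b ([:b + 1:] * [:1, -1:])"
  proof -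
    have "[:b + 1:] * [:1, -1:] = ([:1, 0, -1:] * pderiv 1 + [:b - a, - (a + b + 2):] * 1)
        + [:a + 1:] * [:1, 1:]" by (simp add: algebra_simps)
    then show ?thesis
      by (simp only: jacobi_integral_add[OF 0, of "_ + _"] jacobi_integral_by_parts[OF 0] add_0)
  qed
  have "jacobi_integral a (b + 1) 1 = jacobi_integral a b [:1, 1:]"
    "jacobi_integral (a + 1) b 1 = jacobi_integral a b [:1, -1:]"
    using jacobi_integral_shift[of a 0 b 1 1] jacobi_integral_shift[of a 1 b 0 1] by simp_all
  then show ?case
    using 0 s jacobi_integral_smult[of a b "a + 1" "[:1, 1:]"]
      jacobi_integral_smult[of a b "b + 1" "[:1, -1:]"]
    by (simp add: jacobi_monic_norm2_def jacobi_monic_0 mu_inner_eq)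
next
  case (Suc n)
  let ?k = "real n + a + b + 3"
  have k: "?k > 0" using Suc.prems by simp
  have 1: "?k * jacobi_monic_norm2 a (b + 1) (Suc n) =
      (real n + 1) * jacobi_monic_norm2 (a + 1) (b + 1 + 1) n"
    using jacobi_monic_norm2_Suc[of a "b + 1" n] Suc.prems by (simp add: algebra_simps)
  have 2: "?k * jacobi_monic_norm2 (a + 1) b (Suc n) =
      (real n + 1) * jacobi_monic_norm2 (a + 1 + 1) (b + 1) n"
    using jacobi_monic_norm2_Suc[of "a + 1" b n] Suc.prems by (simp add: algebra_simps)
  have 3: "(real n + a + 2) * jacobi_monic_norm2 (a + 1) (b + 1 + 1) n =
     (real n + b + 2) * jacobi_monic_norm2 (a + 1 + 1) (b + 1) n"
    using Suc.IH[of "a + 1" "b + 1"] Suc.prems by (simp add: algebra_simps)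
  have "?k * ((real n + a + 2) * jacobi_monic_norm2 a (b + 1) (Suc n)) =
      (real n + 1) * ((real n + a + 2) * jacobi_monic_norm2 (a + 1) (b + 1 + 1) n)"
    using 1 by algebra
  also have "\<dots> = ?k * ((real n + b + 2) * jacobi_monic_norm2 (a + 1) b (Suc n))"
    unfolding 3 using 2 by algebra
  finally have "(real n + a + 2) * jacobi_monic_norm2 a (b + 1) (Suc n) =
      (real n + b + 2) * jacobi_monic_norm2 (a + 1) b (Suc n)"
    using k by (simp only: mult_cancel_left) simp
  moreover have "real (Suc n) + a + 1 = real n + a + 2" "real (Suc n) + b + 1 = real n + b + 2"
    by simp_all
  ultimately show ?case by (simp only:)
qed

text \<open>
  The parameters move from \<open>(a, b + 2)\<close> to \<open>(a + 1, b + 1)\<close> by \<open>jacobi_monic_norm2_swap\<close> and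
  from there to \<open>(a, b)\<close>, with the degree raised by 1, by \<open>jacobi_monic_norm2_Suc\<close>.
\<close>

lemma jacobi_monic_norm2_shift:
  assumes ab: "a > -1" "b > -1"
  shows "jacobi_monic_norm2 a (b + 2) n =
     (real n + b + 2) * (real n + a + b + 2) / ((real n + a + 1) * (real n + 1))
       * jacobi_monic_norm2 a b (Suc n)"
proof -
  have 1: "(real n + a + 1) * jacobi_monic_norm2 a (b + 2) n =
     (real n + b + 2) * jacobi_monic_norm2 (a + 1) (b + 1) n"
    using jacobi_monic_norm2_swap[of a "b + 1" n] ab by (simp add: algebra_simps)
  have 2: "jacobi_monic_norm2 (a + 1) (b + 1) n =
      (real n + a + b + 2) * jacobi_monic_norm2 a b (Suc n) / (real n + 1)"
    using jacobi_monic_norm2_Suc[OF ab, of n] by (simp add: field_simps)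
  have "jacobi_monic_norm2 a (b + 2) n =
      (real n + b + 2) * jacobi_monic_norm2 (a + 1) (b + 1) n / (real n + a + 1)"
    using 1 ab by (simp add: field_simps)
  then show ?thesis unfolding 2 by (simp add: mult_ac)
qed

lemma jacobi_monic_norm2_shift_ratio_tendsto:
  assumes ab: "a > -1" "b > -1"
  shows "(\<lambda>n. jacobi_monic_norm2 a (b + 4) n / jacobi_monic_norm2 a b (Suc (Suc n)))
    \<longlonglongrightarrow> 1"
proof -
  have "jacobi_monic_norm2 a (b + 4) n / jacobi_monic_norm2 a b (Suc (Suc n)) =
     (real n + b + 4) * (real n + a + b + 4) / ((real n + a + 1) * (real n + 1)) *
     ((real n + b + 3) * (real n + a + b + 3) / ((real n + a + 2) * (real n + 2)))" for n
  proof -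
    have "jacobi_monic_norm2 a (b + 4) n =
        (real n + b + 4) * (real n + a + b + 4) / ((real n + a + 1) * (real n + 1))
          * jacobi_monic_norm2 a (b + 2) (Suc n)"
    proof -
      have "b + 2 + 2 = b + 4" "real n + (b + 2) + 2 = real n + b + 4"
        "real n + a + (b + 2) + 2 = real n + a + b + 4" by simp_all
      moreover have "b + 2 > -1" using ab by simp
      ultimately show ?thesis using jacobi_monic_norm2_shift[OF ab(1), of "b + 2" n]
        by (simp only:)
    qed
    moreover have "jacobi_monic_norm2 a (b + 2) (Suc n) =
        (real n + b + 3) * (real n + a + b + 3) / ((real n + a + 2) * (real n + 2))
          * jacobi_monic_norm2 a b (Suc (Suc n))"
    proof -
      have "real (Suc n) + b + 2 = real n + b + 3" "real (Suc n) + a + 1 = real n + a + 2"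
        "real (Suc n) + a + b + 2 = real n + a + b + 3" "real (Suc n) + 1 = real n + 2"
        by simp_all
      then show ?thesis using jacobi_monic_norm2_shift[OF ab, of "Suc n"] by (simp only:)
    qed
    moreover have "jacobi_monic_norm2 a b (Suc (Suc n)) \<noteq> 0"
      using jacobi_monic_norm2_pos[OF ab, of "Suc (Suc n)"] by simp
    moreover have "x / z = A * B" if "x = A * y" "y = B * z" "z \<noteq> 0" for x y z A B :: real
      using that by simp
    ultimately show ?thesis by blast
  qed
  moreover have "(\<lambda>n. (real n + b + 4) * (real n + a + b + 4) / ((real n + a + 1) * (real n + 1)) *
     ((real n + b + 3) * (real n + a + b + 3) / ((real n + a + 2) * (real n + 2)))) \<longlonglongrightarrow> 1"
    by real_asymp
  ultimately show ?thesis by simp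
qed

section \<open>The Sobolev norms\<close>

definition jacobi_tilde_coeff :: "real \<Rightarrow> real \<Rightarrow> nat \<Rightarrow> real" where
  "jacobi_tilde_coeff a b n =
     pochhammer (real n + a + b + 1) n / (2 ^ n * pochhammer (a + 1) n)"

lemma jacobi_tilde_coeff_pos:
  assumes "a > -1" "b > -1"
  shows "jacobi_tilde_coeff a b n > 0"
proof -
  (* For n = 0 the base a + b + 1 may be negative, but then the product is empty. *)
  have "pochhammer (real n + a + b + 1) n > 0"
    using assms by (cases n) (auto intro!: pochhammer_pos)
  moreover have "pochhammer (a + 1) n > 0" using assms by (intro pochhammer_pos) auto
  ultimately show ?thesis by (simp add: jacobi_tilde_coeff_def)
qed

lemma mu_norm_jacobi_tilde:
  "mu_norm a b (jacobi_tilde a b n) =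
     sqrt ((jacobi_tilde_coeff a b n)\<^sup>2 * jacobi_monic_norm2 a b n)"
  by (simp add: mu_norm_def jacobi_tilde_def jacobi_tilde_coeff_def[symmetric] mu_inner_eq
      jacobi_integral_smult jacobi_monic_norm2_def power2_eq_square)

context
  fixes a b M N :: real
  assumes ab: "a > -1" "b > -1" and MN: "M \<ge> 0" "N \<ge> 0"
begin

interpretation sob: poly_inner_product "sobolev_inner a b M N"
  by (rule poly_inner_product_sobolev[OF ab MN])

lemma jacobi_sobolev_eq:
  "jacobi_sobolev a b M N = orthogonal_polys (sobolev_inner a b M N) (jacobi_tilde_coeff a b)"
proof -
  have "lead_coeff (jacobi_tilde a b n) = jacobi_tilde_coeff a b n" for n
    by (simp only: jacobi_tilde_def jacobi_tilde_coeff_def lead_coeff_smult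
        degree_jacobi_monic[OF ab] coeff_jacobi_monic[OF ab] mult_1_right)
  then show ?thesis by (simp add: jacobi_sobolev_def)
qed

lemma sobolev_norm_lower:
  "mu_norm a b (jacobi_tilde a b n) \<le> sobolev_norm a b M N (jacobi_sobolev a b M N n)"
proof -
  let ?Q = "jacobi_sobolev a b M N n"
  have c: "jacobi_tilde_coeff a b k \<noteq> 0" for k
    using jacobi_tilde_coeff_pos[OF ab, of k] by simp
  have "(coeff ?Q n)\<^sup>2 * jacobi_monic_norm2 a b n \<le> mu_inner a b ?Q ?Q"
    by (intro jacobi_monic_minimal[OF ab])
       (simp add: jacobi_sobolev_eq sob.degree_orthogonal_polys[OF c])
  moreover have "coeff ?Q n = jacobi_tilde_coeff a b n"
    by (simp add: jacobi_sobolev_eq sob.coeff_orthogonal_polys[OF c])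
  moreover have "mu_inner a b ?Q ?Q \<le> sobolev_inner a b M N ?Q ?Q"
    using MN by (simp add: sobolev_inner_def mult.assoc)
  ultimately show ?thesis by (simp add: mu_norm_jacobi_tilde sobolev_norm_def)
qed

text \<open>
  The test polynomial \<open>s\<close> has a double zero at \<open>-1\<close>, where the masses sit. It is the best such
  polynomial for \<open>\<mu>\<close>, because its factor \<open>(1 + x)\<^sup>2\<close>, squared, can be absorbed in the weight.
\<close>

lemma sobolev_norm_upper:
  "sobolev_norm a b M N (jacobi_sobolev a b M N (Suc (Suc n))) \<le>
     sqrt ((jacobi_tilde_coeff a b (Suc (Suc n)))\<^sup>2 * jacobi_monic_norm2 a (b + 4) n)"
proof -
  define c where "c = jacobi_tilde_coeff a b"
  have c: "c k \<noteq> 0" for k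
    using jacobi_tilde_coeff_pos[OF ab, of k] by (simp add: c_def)
  have ab4: "a > -1" "b + 4 > -1" using ab by auto
  let ?m = "Suc (Suc n)"
  let ?Q = "jacobi_sobolev a b M N ?m"
  let ?p = "jacobi_monic a (b + 4) n"
  let ?s = "[:1, 1:]\<^sup>2 * ?p"
  have p: "degree ?p = n" "coeff ?p n = 1"
    by (rule degree_jacobi_monic[OF ab4] coeff_jacobi_monic[OF ab4])+
  then have [simp]: "?p \<noteq> 0" by auto
  have deg: "degree ?s = ?m"
    using p by (subst degree_mult_eq) (auto simp: power2_eq_square)
  have "lead_coeff ?s = 1"
    by (simp add: lead_coeff_mult lead_coeff_power p)
  then have co: "coeff ?s ?m = 1" using deg by simp
  have "(1 / c ?m)\<^sup>2 * sobolev_inner a b M N ?Q ?Q \<le> sobolev_inner a b M N ?s ?s"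
    using sob.orthogonal_polys_minimal[OF c, of ?s ?m] deg co by (simp add: jacobi_sobolev_eq c_def)
  also have "\<dots> = mu_inner a b ?s ?s"
  proof -
    have "poly ?s (-1) = 0" by simp
    moreover have "poly (pderiv ?s) (-1) = 0"
      by (simp only: pderiv_mult power2_eq_square poly_add poly_mult) simp
    ultimately show ?thesis by (simp only: sobolev_inner_def mult_zero_right add_0_right)
  qed
  also have "\<dots> = jacobi_monic_norm2 a (b + 4) n"
  proof -
    have "1 * A ^ 4 * (q * q) = A\<^sup>2 * q * (A\<^sup>2 * q)" for A q :: "real poly"
      by (simp add: power2_eq_square power4_eq_xxxx mult_ac)
    then have "[:1, -1:] ^ 0 * [:1, 1:] ^ 4 * (?p * ?p) = ?s * ?s"
      by (simp only: power_0)
    then show ?thesis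
      using jacobi_integral_shift[of a 0 b 4 "?p * ?p"]
      by (simp only: jacobi_monic_norm2_def mu_inner_eq) simp
  qed
  finally have "sobolev_inner a b M N ?Q ?Q \<le> (c ?m)\<^sup>2 * jacobi_monic_norm2 a (b + 4) n"
    using c[of ?m] by (simp add: power_divide divide_le_eq mult.commute)
  then show ?thesis by (simp add: sobolev_norm_def c_def)
qed

end

theorem proposition4p2:
  fixes \<alpha> \<beta> M N :: real
  assumes "\<alpha> > -1" and "\<beta> > -1" and "M > 0" and "N > 0"
  shows "(\<lambda>n. sobolev_norm \<alpha> \<beta> M N (jacobi_sobolev \<alpha> \<beta> M N n)
              / mu_norm \<alpha> \<beta> (jacobi_tilde \<alpha> \<beta> n)) \<longlonglongrightarrow> 1"
proof -
  have ab: "\<alpha> > -1" "\<beta> > -1" and MN: "M \<ge> 0" "N \<ge> 0" using assms by auto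
  let ?r = "\<lambda>n. sobolev_norm \<alpha> \<beta> M N (jacobi_sobolev \<alpha> \<beta> M N n)
              / mu_norm \<alpha> \<beta> (jacobi_tilde \<alpha> \<beta> n)"
  let ?u = "\<lambda>n. sqrt (jacobi_monic_norm2 \<alpha> (\<beta> + 4) n / jacobi_monic_norm2 \<alpha> \<beta> (Suc (Suc n)))"
  have norm_pos: "mu_norm \<alpha> \<beta> (jacobi_tilde \<alpha> \<beta> n) > 0" for n
    using jacobi_tilde_coeff_pos[OF ab, of n] jacobi_monic_norm2_pos[OF ab, of n]
    by (simp add: mu_norm_jacobi_tilde)
  have lower: "1 \<le> ?r n" for n
    using norm_pos[of n] sobolev_norm_lower[OF ab MN, of n] by simp
  have upper: "?r (Suc (Suc n)) \<le> ?u n" for n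
  proof -
    let ?c = "jacobi_tilde_coeff \<alpha> \<beta> (Suc (Suc n))"
    have "?r (Suc (Suc n)) \<le> sqrt (?c\<^sup>2 * jacobi_monic_norm2 \<alpha> (\<beta> + 4) n)
        / mu_norm \<alpha> \<beta> (jacobi_tilde \<alpha> \<beta> (Suc (Suc n)))"
      using sobolev_norm_upper[OF ab MN, of n] norm_pos[of "Suc (Suc n)"]
      by (intro divide_right_mono) auto
    also have "\<dots> = ?u n"
      using jacobi_tilde_coeff_pos[OF ab, of "Suc (Suc n)"]
      by (simp add: mu_norm_jacobi_tilde real_sqrt_mult real_sqrt_divide)
    finally show ?thesis .
  qed
  have "?u \<longlonglongrightarrow> sqrt 1"
    by (intro tendsto_real_sqrt jacobi_monic_norm2_shift_ratio_tendsto ab)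
  then have "?u \<longlonglongrightarrow> 1" by simp
  then have "(\<lambda>n. ?r (Suc (Suc n))) \<longlonglongrightarrow> 1"
    by (rule tendsto_sandwich[rotated 3]) (use lower upper in auto)
  then show ?thesis by (simp only: filterlim_sequentially_Suc[of ?r]
        filterlim_sequentially_Suc[of "\<lambda>n. ?r (Suc n)"])
qed

end
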